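(* Let $1<p<q<p^*$ and $c>0$. The quantity $\mu_{p,q}(\Omega)$ cannot be bounded from below in terms of $\mathrm{diam}(\Omega)$ only; in other words, \[ \inf\Big\{\mu_{p,q}(\Omega)\ :\ \Omega\subset\mathbb{R}^N \text{ open, bounded and convex},\ \mathrm{diam}(\Omega)\le c\Big\}=0. \] A minimizing sequence is given by any family $\{\Omega_k\}_{k\in\mathbb{N}}$ of open bounded convex subsets of $\mathbb{R}^N$ such that $\lim_{k\to\infty}|\Omega_k|=0$ and $\mathrm{diam}(\Omega_k)=c$; i.e. for any such family, $\lim_{k\to\infty}\mu_{p,q}(\Omega_k)=0$.
   Context: For $1<p<\infty$, set $p^*=\frac{Np}{N-p}$ if $p<N$ and $p^*=+\infty$ if $p\ge N$. For an open bounded Lipschitz set $\Omega\subset\mathbb{R}^N$ and $1<q<p^*$, define \[ \mu_{p,q}(\Omega)=\inf_{v\in W^{1,p}(\Omega)\setminus\{0\}}\left\{\frac{\int_\Omega|\nabla v|^p\,dx}{\left(\int_\Omega|v|^q\,dx\right)^{p/q}}\ :\ \int_\Omega|v|^{q-2}v\,dx=0\right\}. \] $|\cdot|$ applied to a set denotes $N$-dimensional Lebesgue measure and $\mathrm{diam}$ denotes the diameter.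
   Formalization: The dimension N ≥ 2 is assumed: for N = 1 the sets are intervals of length L ≤ c, on which μ_{p,q} = L^{1-p-p/q} μ_{p,q}((0,1)) is bounded below by a positive constant, so the infimum is not 0, and no family with |Ω_k| → 0 and diam(Ω_k) = c exists. *)

theory Defs
  imports "HOL-Analysis.Analysis"
begin

text \<open>Throughout, functions on \<open>\<Omega>\<close> are represented by total functions whose values outside
  \<open>\<Omega>\<close> are irrelevant; equality of Sobolev functions is equality almost everywhere on \<open>\<Omega>\<close>.\<close>

primrec C_k :: "nat \<Rightarrow> ('a::euclidean_space \<Rightarrow> real) \<Rightarrow> bool" where
  "C_k 0 f \<longleftrightarrow> continuous_on UNIV f"
| "C_k (Suc n) f \<longleftrightarrow>
     (\<forall>x. f differentiable (at x)) \<and>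
     (\<forall>i\<in>Basis. C_k n (\<lambda>x. frechet_derivative f (at x) i))"

definition test_function :: "'a::euclidean_space set \<Rightarrow> ('a \<Rightarrow> real) \<Rightarrow> bool" where
  "test_function \<Omega> \<phi> \<longleftrightarrow>
     (\<forall>n. C_k n \<phi>) \<and> compact (closure {x. \<phi> x \<noteq> 0}) \<and> closure {x. \<phi> x \<noteq> 0} \<subseteq> \<Omega>"

definition locally_integrable_on ::
    "('a::euclidean_space \<Rightarrow> 'b::euclidean_space) \<Rightarrow> 'a set \<Rightarrow> bool" where
  "locally_integrable_on f \<Omega> \<longleftrightarrow> (\<forall>K. compact K \<and> K \<subseteq> \<Omega> \<longrightarrow> set_integrable lebesgue K f)"

definition has_weak_gradient ::
    "'a::euclidean_space set \<Rightarrow> ('a \<Rightarrow> real) \<Rightarrow> ('a \<Rightarrow> 'a) \<Rightarrow> bool" where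
  "has_weak_gradient \<Omega> v g \<longleftrightarrow>
     locally_integrable_on v \<Omega> \<and> locally_integrable_on g \<Omega> \<and>
     (\<forall>\<phi>. test_function \<Omega> \<phi> \<longrightarrow>
       (\<forall>i\<in>Basis.
          (\<integral>x. v x * frechet_derivative \<phi> (at x) i \<partial>lebesgue_on \<Omega>) =
          - (\<integral>x. (g x \<bullet> i) * \<phi> x \<partial>lebesgue_on \<Omega>)))"

definition L_space ::
    "real \<Rightarrow> 'a::euclidean_space set \<Rightarrow> ('a \<Rightarrow> 'b::euclidean_space) set" where
  "L_space p \<Omega> = {f. f \<in> borel_measurable (lebesgue_on \<Omega>) \<and>
                     integrable (lebesgue_on \<Omega>) (\<lambda>x. norm (f x) powr p)}"

definition sobolev_W1 :: "real \<Rightarrow> 'a::euclidean_space set \<Rightarrow> ('a \<Rightarrow> real) set" where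
  "sobolev_W1 p \<Omega> = {v \<in> L_space p \<Omega>. \<exists>g \<in> L_space p \<Omega>. has_weak_gradient \<Omega> v g}"

definition sobolev_exponent :: "nat \<Rightarrow> real \<Rightarrow> ereal" where
  "sobolev_exponent N p = (if p < real N then ereal (real N * p / (real N - p)) else \<infinity>)"

text \<open>The weak gradient \<open>g\<close> of \<open>v\<close> is unique up to null sets, so the quotient depends on \<open>v\<close> only.
  For a bounded Lipschitz (in particular, bounded convex) open set and \<open>1 < q < p\<^sup>*\<close>, the
  condition \<open>v \<in> L_space q \<Omega>\<close> follows from the Sobolev embedding; it is listed because
  Bochner integrals of non-integrable functions are \<open>0\<close> by convention, and it makes both
  integrals of \<open>v\<close> meaningful. The infimum is taken in \<open>ereal\<close>, so that it is \<open>\<infinity>\<close> if there is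
  no admissible function, as for \<open>\<Omega> = {}\<close>.\<close>

definition mu :: "real \<Rightarrow> real \<Rightarrow> 'a::euclidean_space set \<Rightarrow> ereal" where
  "mu p q \<Omega> = Inf
     {ereal ((\<integral>x. norm (g x) powr p \<partial>lebesgue_on \<Omega>) /
             (\<integral>x. \<bar>v x\<bar> powr q \<partial>lebesgue_on \<Omega>) powr (p / q)) | v g.
        v \<in> sobolev_W1 p \<Omega> \<and> g \<in> L_space p \<Omega> \<and> has_weak_gradient \<Omega> v g \<and>
        \<not> (AE x in lebesgue_on \<Omega>. v x = 0) \<and>
        v \<in> L_space q \<Omega> \<and>
        (\<integral>x. \<bar>v x\<bar> powr (q - 2) * v x \<partial>lebesgue_on \<Omega>) = 0}"

end

theory Submission imports Defs begin

text \<open>An affine function \<open>v x = e \<bullet> x - t\<close> has gradient of norm \<open>1\<close>, and \<open>t\<close> can be chosen to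
  satisfy the nonlinear mean condition. If the unit vector \<open>e\<close> points along an almost maximal
  segment of a convex set of diameter \<open>d\<close>, then \<open>\<bar>v\<bar> \<ge> d / 8\<close> on a fixed fraction of the set, so
  the quotient is at most a constant times \<open>\<bar>\<Omega>\<bar> powr (1 - p / q)\<close>. As \<open>p < q\<close>, this tends to \<open>0\<close>
  with the measure; intersections of a ball with thin slabs have vanishing measure and constant
  diameter.\<close>

section \<open>Integrability of continuous functions\<close>

text \<open>Used with \<open>S\<close> a bounded set and \<open>K\<close> a closed ball around it:
  continuity on the compact ball supplies a bound that continuity on \<open>S\<close> alone would
  not give.\<close>

lemma integrable_on_lebesgue_continuous:
  fixes f :: "'a::euclidean_space \<Rightarrow> 'b::euclidean_space"
  assumes "compact K" "S \<subseteq> K" "S \<in> sets lebesgue" "continuous_on K f"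
  shows "integrable (lebesgue_on S) f"
proof -
  have "set_integrable lborel K f"
    unfolding set_integrable_def by (rule borel_integrable_compact) fact+
  then have "set_integrable lebesgue K f"
    unfolding set_integrable_def using integrable_completion
    by (metis borel_measurable_integrable)
  then have "set_integrable lebesgue S f"
    by (rule set_integrable_subset) fact+
  then show ?thesis
    using assms(3) by (simp add: set_integrable_def integrable_restrict_space)
qed

lemma continuous_imp_locally_integrable_on:
  assumes "continuous_on UNIV f"
  shows "locally_integrable_on f \<Omega>"
  unfolding locally_integrable_on_def
proof (intro allI impI)
  fix K assume "compact K \<and> K \<subseteq> \<Omega>"
  then have "set_integrable lborel K f"
    unfolding set_integrable_def
    by (intro borel_integrable_compact) (use assms continuous_on_subset in auto)
  then show "set_integrable lebesgue K f"
    unfolding set_integrable_def using integrable_completion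
    by (metis borel_measurable_integrable)
qed

section \<open>Weak gradients of affine functions\<close>

lemma integral_lborel_translation:
  fixes f :: "'a::euclidean_space \<Rightarrow> 'b::euclidean_space"
  assumes "f \<in> borel_measurable borel"
  shows "(\<integral>x. f (a + x) \<partial>lborel) = (\<integral>x. f x \<partial>lborel)"
  using integral_distr[of "(+) a" lborel borel f] assms lborel_distr_plus[of a] by simp

text \<open>The difference quotients have integral zero by translation invariance.\<close>
lemma integral_directional_derivative_eq_0:
  fixes f :: "'a::euclidean_space \<Rightarrow> real"
  assumes diff: "\<And>x. f differentiable (at x)"
    and cont: "continuous_on UNIV (\<lambda>x. frechet_derivative f (at x) i)"
    and K: "compact K" "\<And>x. x \<notin> K \<Longrightarrow> f x = 0"
  shows "(\<integral>x. frechet_derivative f (at x) i \<partial>lborel) = 0"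
proof -
  define D where "D = (\<lambda>x. frechet_derivative f (at x) i)"
  have der: "(f has_derivative frechet_derivative f (at x)) (at x)" for x
    using diff frechet_derivative_works by blast
  have contf: "continuous_on UNIV f"
    using der by (meson continuous_at_imp_continuous_on has_derivative_continuous)
  have [measurable]: "f \<in> borel_measurable borel"
    using contf by (rule borel_measurable_continuous_onI)
  have [measurable]: "D \<in> borel_measurable borel"
    using cont unfolding D_def by (rule borel_measurable_continuous_onI)
  have D0: "D x = 0" if "x \<notin> K" for x
  proof -
    have "((\<lambda>_. 0) has_derivative frechet_derivative f (at x)) (at x)"
      by (rule has_derivative_transform_within_open[OF der, of "- K"])
        (use K that in \<open>auto simp: compact_imp_closed\<close>)
    then have "frechet_derivative f (at x) = (\<lambda>_. 0)"
      by (intro has_derivative_unique[OF _ has_derivative_const])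
    then show ?thesis by (simp add: D_def)
  qed
  have "bounded (D ` K)"
    using K(1) cont unfolding D_def
    by (intro compact_imp_bounded compact_continuous_image) (auto intro: continuous_on_subset)
  then obtain B where B: "B > 0" "\<And>x. x \<in> K \<Longrightarrow> \<bar>D x\<bar> \<le> B"
    by (auto simp: bounded_pos)
  have DB: "\<bar>D x\<bar> \<le> B" for x
    using B D0[of x] by (cases "x \<in> K") auto
  have line: "((\<lambda>s. f (x + s *\<^sub>R i)) has_real_derivative D (x + s *\<^sub>R i)) (at s within T)" for x s T
  proof -
    interpret linear "frechet_derivative f (at (x + s *\<^sub>R i))"
      using der has_derivative_linear by blast
    have "((\<lambda>s. f (x + s *\<^sub>R i)) has_derivative
        (\<lambda>h. frechet_derivative f (at (x + s *\<^sub>R i)) (h *\<^sub>R i))) (at s within T)"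
      by (rule has_derivative_compose[OF _ der]) (auto intro!: derivative_eq_intros)
    then show ?thesis
      by (simp add: has_field_derivative_def D_def scaleR mult.commute[of _ "frechet_derivative _ _ _"])
  qed
  define h where "h = (\<lambda>n. inverse (real (Suc n)))"
  have h: "0 < h n" "h n \<le> 1" for n
    by (auto simp: h_def field_simps)
  define u where "u = (\<lambda>n x. (f (h n *\<^sub>R i + x) - f x) / h n)"
  \<comment> \<open>Since \<open>h n \<le> 1\<close>, a difference quotient can be non-zero only
    within distance \<open>norm i\<close> of \<open>K\<close>. Hence the compact set
    \<open>K'\<close> contains the supports of all \<open>u n\<close>, and \<open>B\<close> times
    its indicator dominates the whole sequence.\<close>
  define K' where "K' = {x + y |x y. x \<in> K \<and> y \<in> cball 0 (norm i)}"
  have "compact K'"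
    unfolding K'_def using compact_sums[OF K(1) compact_cball[of 0 "norm i"]] .
  have bound: "norm (u n x) \<le> indicator K' x *\<^sub>R B" for n x
  proof (cases "x \<in> K'")
    case True
    \<comment> \<open>Mean value inequality on the segment from \<open>x\<close> to
      \<open>x + h n *\<^sub>R i\<close>; dividing by \<open>h n\<close> leaves the bound
      \<open>B\<close>, independent of \<open>n\<close>.\<close>
    have "norm (f (x + h n *\<^sub>R i) - f (x + 0 *\<^sub>R i)) \<le> B * norm (h n - 0)"
      by (rule field_differentiable_bound[where S = UNIV, OF _ line]) (use DB in auto)
    then show ?thesis
      using True h(1)[of n] by (simp add: u_def field_simps add.commute)
  next
    case False
    have "x \<notin> K"
      using False unfolding K'_def by (auto intro: exI[of _ x] exI[of _ 0])
    moreover have "h n *\<^sub>R i + x \<notin> K"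
    proof
      assume "h n *\<^sub>R i + x \<in> K"
      moreover have "- (h n *\<^sub>R i) \<in> cball 0 (norm i)"
        using h[of n] by (simp add: mult_left_le_one_le)
      moreover have "x = (h n *\<^sub>R i + x) + - (h n *\<^sub>R i)" by simp
      ultimately show False using False unfolding K'_def by blast
    qed
    ultimately show ?thesis using K(2) B(1) by (simp add: u_def)
  qed
  have lim: "(\<lambda>n. u n x) \<longlonglongrightarrow> D x" for x
  proof -
    have "((\<lambda>s. (f (x + s *\<^sub>R i) - f x) / s) \<longlongrightarrow> D x) (at 0)"
      using line[of x 0 UNIV] by (simp add: has_field_derivative_iff)
    moreover have "filterlim h (at 0) sequentially"
      using h(1) LIMSEQ_inverse_real_of_nat
      by (auto simp: filterlim_at h_def eventually_sequentially)
    ultimately show ?thesis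
      unfolding u_def by (subst add.commute) (rule filterlim_compose)
  qed
  have "integrable lborel (\<lambda>x. indicator K x *\<^sub>R f x)"
    using K(1) contf by (intro borel_integrable_compact) (auto intro: continuous_on_subset)
  moreover have "(\<lambda>x. indicator K x *\<^sub>R f x) = f"
    using K(2) by (auto simp: indicator_def fun_eq_iff)
  ultimately have intf: "integrable lborel f" by simp
  have intft: "integrable lborel (\<lambda>x. f (a + x))" for a
    by (rule integrable_distr[of "(+) a" lborel borel]) (use intf lborel_distr_plus[of a] in auto)
  have "integral\<^sup>L lborel (u n) = 0" for n
    unfolding u_def using intf intft integral_lborel_translation[of f "h n *\<^sub>R i"] by simp
  moreover have "(\<lambda>n. integral\<^sup>L lborel (u n)) \<longlonglongrightarrow> integral\<^sup>L lborel D"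
  proof (rule integral_dominated_convergence)
    show "integrable lborel (\<lambda>x. indicator K' x *\<^sub>R B)"
      using \<open>compact K'\<close> by (intro borel_integrable_compact) auto
  qed (use bound lim in \<open>auto simp: u_def\<close>)
  ultimately show ?thesis
    using LIMSEQ_unique[OF _ tendsto_const] by (simp add: D_def LIMSEQ_const_iff)
qed

text \<open>The product \<open>F\<close> of the affine function and a test function has compact
  support, so its directional derivative integrates to zero. The product rule splits that derivative
  into \<open>A + B\<close>, the two integrands of the weak gradient identity.\<close>

lemma has_weak_gradient_affine:
  fixes e :: "'a::euclidean_space"
  assumes \<Omega>: "\<Omega> \<in> sets lebesgue"
  shows "has_weak_gradient \<Omega> (\<lambda>x. e \<bullet> x - t) (\<lambda>_. e)"
  unfolding has_weak_gradient_def
proof (intro conjI allI impI ballI)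
  show "locally_integrable_on (\<lambda>x. e \<bullet> x - t) \<Omega>" "locally_integrable_on (\<lambda>_. e) \<Omega>"
    by (intro continuous_imp_locally_integrable_on continuous_intros)+
  fix \<phi> :: "'a \<Rightarrow> real" and i :: 'a
  assume \<phi>: "test_function \<Omega> \<phi>" and i: "i \<in> Basis"
  define K where "K = closure {x. \<phi> x \<noteq> 0}"
  have K: "compact K" "K \<subseteq> \<Omega>"
    using \<phi> by (auto simp: test_function_def K_def)
  have \<phi>0: "\<phi> x = 0" if "x \<notin> K" for x
    using that closure_subset[of "{x. \<phi> x \<noteq> 0}"] by (auto simp: K_def)
  have "C_k (Suc 0) \<phi>"
    using \<phi> unfolding test_function_def by blast
  then have diff: "\<phi> differentiable (at x)"
    and contD: "continuous_on UNIV (\<lambda>x. frechet_derivative \<phi> (at x) i)" for x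
    using i by auto
  have der: "(\<phi> has_derivative frechet_derivative \<phi> (at x)) (at x)" for x
    using diff frechet_derivative_works by blast
  have cont\<phi>: "continuous_on UNIV \<phi>"
    using der by (meson continuous_at_imp_continuous_on has_derivative_continuous)
  have D0: "frechet_derivative \<phi> (at x) i = 0" if "x \<notin> K" for x
  proof -
    have "((\<lambda>_. 0) has_derivative frechet_derivative \<phi> (at x)) (at x)"
      by (rule has_derivative_transform_within_open[OF der, of "- K"])
        (use K \<phi>0 that in \<open>auto simp: compact_imp_closed\<close>)
    then have "frechet_derivative \<phi> (at x) = (\<lambda>_. 0)"
      by (intro has_derivative_unique[OF _ has_derivative_const])
    then show ?thesis by simp
  qed
  define F where "F = (\<lambda>x. (e \<bullet> x - t) * \<phi> x)"
  define A where "A = (\<lambda>x. (e \<bullet> x - t) * frechet_derivative \<phi> (at x) i)"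
  define B where "B = (\<lambda>x. (e \<bullet> i) * \<phi> x)"
  have Fder: "(F has_derivative (\<lambda>h. (e \<bullet> x - t) * frechet_derivative \<phi> (at x) h + (e \<bullet> h) * \<phi> x)) (at x)"
    for x
    unfolding F_def by (auto intro!: derivative_eq_intros der)
  have FD: "frechet_derivative F (at x) i = A x + B x" for x
    unfolding A_def B_def frechet_derivative_at[OF Fder, symmetric] ..
  have contA: "continuous_on UNIV A" and contB: "continuous_on UNIV B"
    unfolding A_def B_def by (intro continuous_intros contD cont\<phi>)+
  have "(\<integral>x. frechet_derivative F (at x) i \<partial>lborel) = 0"
  proof (rule integral_directional_derivative_eq_0[OF _ _ K(1)])
    show "F differentiable at x" for x
      using Fder differentiable_def by blast
    show "continuous_on UNIV (\<lambda>x. frechet_derivative F (at x) i)"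
      unfolding FD by (intro continuous_intros contA contB)
  qed (simp add: F_def \<phi>0)
  \<comment> \<open>Functions vanishing off \<open>K\<close>, hence off \<Omega>, have the same
    integral over \<Omega> as over the whole space. This carries the identity from
    \<open>lborel\<close> back to \<open>lebesgue_on \<Omega>\<close>.\<close>
  moreover have supp: "integrable lborel G \<and> integral\<^sup>L (lebesgue_on \<Omega>) G = integral\<^sup>L lborel G"
    if "continuous_on UNIV G" "\<And>x. x \<notin> K \<Longrightarrow> G x = 0" for G :: "'a \<Rightarrow> real"
  proof
    have "integrable lborel (\<lambda>x. indicator K x *\<^sub>R G x)"
      using K(1) that(1) by (intro borel_integrable_compact) (auto intro: continuous_on_subset)
    moreover have "(\<lambda>x. indicator K x *\<^sub>R G x) = G"
      using that(2) by (auto simp: indicator_def fun_eq_iff)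
    ultimately show "integrable lborel G" by simp
    have "(\<lambda>x. indicator \<Omega> x *\<^sub>R G x) = G"
      using that(2) K(2) by (auto simp: indicator_def fun_eq_iff)
    then have "integral\<^sup>L (lebesgue_on \<Omega>) G = integral\<^sup>L lebesgue G"
      using \<Omega> by (subst integral_restrict_space) auto
    also have "\<dots> = integral\<^sup>L lborel G"
      using that(1) by (intro integral_completion) (simp add: borel_measurable_continuous_onI)
    finally show "integral\<^sup>L (lebesgue_on \<Omega>) G = integral\<^sup>L lborel G" .
  qed
  moreover have "integrable lborel A \<and> integral\<^sup>L (lebesgue_on \<Omega>) A = integral\<^sup>L lborel A"
    by (rule supp[OF contA]) (simp add: A_def D0)
  moreover have "integrable lborel B \<and> integral\<^sup>L (lebesgue_on \<Omega>) B = integral\<^sup>L lborel B"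
    by (rule supp[OF contB]) (simp add: B_def \<phi>0)
  ultimately have "integral\<^sup>L (lebesgue_on \<Omega>) A = - integral\<^sup>L (lebesgue_on \<Omega>) B"
    by (simp add: FD)
  then show "(\<integral>x. (e \<bullet> x - t) * frechet_derivative \<phi> (at x) i \<partial>lebesgue_on \<Omega>) =
      - (\<integral>x. (e \<bullet> i) * \<phi> x \<partial>lebesgue_on \<Omega>)"
    by (simp add: A_def B_def)
qed

section \<open>The nonlinear mean condition\<close>

text \<open>For \<open>r < 2\<close> the factor with exponent \<open>r - 2\<close> is unbounded near
  \<open>0\<close>, so continuity of the factors cannot be used. Rewriting the product through the
  positive and negative parts of \<open>s\<close> leaves only the positive exponent
  \<open>r - 1\<close>; at \<open>s = 0\<close> both sides agree because
  \<open>0 powr x = 0\<close>.\<close>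

lemma continuous_on_signed_powr:
  fixes r :: real
  assumes "1 < r"
  shows "continuous_on UNIV (\<lambda>s::real. \<bar>s\<bar> powr (r - 2) * s)"
proof -
  have "\<bar>s\<bar> powr (r - 2) * s = max s 0 powr (r - 1) - max (- s) 0 powr (r - 1)" for s :: real
  proof (cases "s = 0")
    case False
    then have "\<bar>s\<bar> powr (r - 1) = \<bar>s\<bar> powr (r - 2) * \<bar>s\<bar>"
      using powr_mult_base[of "\<bar>s\<bar>" "r - 2"] by (simp add: mult.commute)
    then show ?thesis by (cases "s > 0") (auto simp: max_def)
  qed auto
  moreover have "continuous_on UNIV (\<lambda>s::real. max s 0 powr (r - 1) - max (- s) 0 powr (r - 1))"
    using assms by (intro continuous_intros continuous_on_powr') auto
  ultimately show ?thesis by presburger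
qed

text \<open>Intermediate value theorem in \<open>t\<close>: when \<open>t\<close> passes from below
  all values of \<open>e \<bullet> x\<close> to above them, the integrand changes from nonnegative
  to nonpositive, and the integral depends continuously on \<open>t\<close>.\<close>

lemma exists_signed_powr_centre:
  fixes e :: "'a::euclidean_space"
  assumes q: "1 < q" and \<Omega>: "bounded \<Omega>" "\<Omega> \<in> sets lebesgue"
  shows "\<exists>t. (\<integral>x. \<bar>e \<bullet> x - t\<bar> powr (q - 2) * (e \<bullet> x - t) \<partial>lebesgue_on \<Omega>) = 0"
proof -
  define g where "g = (\<lambda>s::real. \<bar>s\<bar> powr (q - 2) * s)"
  have contg: "continuous_on UNIV g"
    unfolding g_def by (rule continuous_on_signed_powr) fact
  obtain R where R: "R > 0" "\<Omega> \<subseteq> cball 0 R"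
    by (meson \<Omega>(1) bounded_pos subsetI mem_cball_0)
  define M where "M = norm e * R"
  have M: "\<bar>e \<bullet> x\<bar> \<le> M" if "x \<in> \<Omega>" for x
  proof -
    have "\<bar>e \<bullet> x\<bar> \<le> norm e * norm x" by (rule Cauchy_Schwarz_ineq2)
    also have "\<dots> \<le> M" using R that unfolding M_def by (intro mult_left_mono) auto
    finally show ?thesis .
  qed
  have "0 \<le> M" using R by (simp add: M_def)
  define I where "I = (\<lambda>t. \<integral>x. g (e \<bullet> x - t) \<partial>lebesgue_on \<Omega>)"
  have cg: "continuous_on UNIV (\<lambda>x. g (e \<bullet> x - t))" for t
    by (intro continuous_on_compose2[OF contg] continuous_intros) auto
  have int: "integrable (lebesgue_on \<Omega>) (\<lambda>x. g (e \<bullet> x - t))" for t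
    using R \<Omega> by (intro integrable_on_lebesgue_continuous[of "cball 0 R"])
      (auto intro: continuous_on_subset[OF cg])
  \<comment> \<open>For \<open>x\<close> in \<Omega> and \<open>t\<close> in \<open>{-M..M}\<close>
    the argument \<open>e \<bullet> x - t\<close> has absolute value at most \<open>2 * M\<close>. A
    single constant \<open>C\<close> therefore dominates all integrands, and it is integrable
    because \<Omega> has finite measure.\<close>
  have "bounded (g ` cball 0 (2 * M))"
    by (intro compact_imp_bounded compact_continuous_image continuous_on_subset[OF contg]) auto
  then obtain C where C: "\<And>s. \<bar>s\<bar> \<le> 2 * M \<Longrightarrow> \<bar>g s\<bar> \<le> C"
    unfolding bounded_iff by (force simp: dist_real_def)
  have fin: "finite_measure (lebesgue_on \<Omega>)"
    using \<Omega> by (intro finite_measure_lebesgue_on) (simp add: bounded_set_imp_lmeasurable)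
  have "continuous_on {-M..M} I"
    unfolding continuous_on_sequentially
  proof (intro allI ballI impI)
    fix t :: "nat \<Rightarrow> real" and a
    assume t: "a \<in> {-M..M}" "(\<forall>n. t n \<in> {-M..M}) \<and> t \<longlonglongrightarrow> a"
    have "(\<lambda>n. I (t n)) \<longlonglongrightarrow> I a"
      unfolding I_def
    proof (rule integral_dominated_convergence[where w = "\<lambda>_. C"])
      show "integrable (lebesgue_on \<Omega>) (\<lambda>_. C)"
        using fin by (rule finite_measure.integrable_const)
      show "AE x in lebesgue_on \<Omega>. (\<lambda>n. g (e \<bullet> x - t n)) \<longlonglongrightarrow> g (e \<bullet> x - a)"
        using t by (auto intro!: AE_I2 continuous_on_tendsto_compose[OF contg] tendsto_intros)
      show "AE x in lebesgue_on \<Omega>. norm (g (e \<bullet> x - t n)) \<le> C" for n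
      proof (rule AE_I2)
        fix x assume "x \<in> space (lebesgue_on \<Omega>)"
        then have "\<bar>e \<bullet> x\<bar> \<le> M" using M by simp
        moreover have "-M \<le> t n" "t n \<le> M" using t by auto
        ultimately have "\<bar>e \<bullet> x - t n\<bar> \<le> 2 * M" by linarith
        then show "norm (g (e \<bullet> x - t n)) \<le> C" using C by simp
      qed
    qed (use int in \<open>auto intro: borel_measurable_integrable\<close>)
    then show "(I \<circ> t) \<longlonglongrightarrow> I a" by (simp add: o_def)
  qed
  moreover have "I M \<le> 0"
  proof -
    have "I M \<le> (\<integral>x. 0 \<partial>lebesgue_on \<Omega>)"
      unfolding I_def using M
      by (intro integral_mono int) (auto simp: g_def mult_nonneg_nonpos abs_le_iff)
    then show ?thesis by simp
  qed
  moreover have "0 \<le> I (- M)"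
    unfolding I_def
  proof (rule integral_nonneg_AE, rule AE_I2)
    fix x assume "x \<in> space (lebesgue_on \<Omega>)"
    then have "\<bar>e \<bullet> x\<bar> \<le> M" using M by simp
    then have "0 \<le> e \<bullet> x - - M" by linarith
    then show "0 \<le> g (e \<bullet> x - - M)" unfolding g_def by (intro mult_nonneg_nonneg) auto
  qed
  ultimately obtain t where "I t = 0"
    using IVT2'[of I M 0 "- M"] \<open>0 \<le> M\<close> by auto
  then show ?thesis unfolding I_def g_def by blast
qed

section \<open>Lower bound for the denominator of the quotient\<close>

text \<open>One endpoint of the segment lies at height at least \<open>d / 4\<close> from level \<open>t\<close>; contracting the
  convex set by the factor \<open>1 / 8\<close> towards it stays in the set and at height at least \<open>d / 8\<close>.\<close>
lemma affine_powr_integral_lower_bound: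
  fixes \<Omega> :: "'a::euclidean_space set"
  assumes \<Omega>: "open \<Omega>" "bounded \<Omega>" "convex \<Omega>" "diameter \<Omega> = d"
    and ab: "a \<in> \<Omega>" "b \<in> \<Omega>" "e \<bullet> b - e \<bullet> a > d / 2" and e: "norm e = 1"
    and d: "0 < d" and q: "0 < q"
  shows "(d / 8) powr q * (1 / 8) ^ DIM('a) * measure lebesgue \<Omega>
    \<le> (\<integral>x. \<bar>e \<bullet> x - t\<bar> powr q \<partial>lebesgue_on \<Omega>)"
proof -
  have "\<bar>e \<bullet> a - t\<bar> \<ge> d / 4 \<or> \<bar>e \<bullet> b - t\<bar> \<ge> d / 4"
    using ab(3) by linarith
  then obtain z where z: "z \<in> \<Omega>" "\<bar>e \<bullet> z - t\<bar> \<ge> d / 4"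
    using ab by blast
  \<comment> \<open>With ratio \<open>1 / 8\<close> the height of a point of \<open>S\<close>
    differs from that of \<open>z\<close> by at most \<open>d / 8\<close>, which is half of the
    \<open>d / 4\<close> available at \<open>z\<close>.\<close>
  define S where "S = (\<lambda>x. (1 / 8) *\<^sub>R x + (7 / 8) *\<^sub>R z) ` \<Omega>"
  have \<Omega>L: "\<Omega> \<in> lmeasurable"
    using \<Omega> by (simp add: lmeasurable_open)
  have S\<Omega>: "S \<subseteq> \<Omega>"
    unfolding S_def using \<Omega>(3) z(1) by (auto intro!: convexD)
  have "open S"
    using open_affinity[OF \<Omega>(1), of "1 / 8" "(7 / 8) *\<^sub>R z"] unfolding S_def
    by (simp add: add.commute)
  then have SL: "S \<in> lmeasurable"
    using S\<Omega> \<Omega>(2) bounded_subset lmeasurable_open by blast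
  have mS: "measure lebesgue S = (1 / 8) ^ DIM('a) * measure lebesgue \<Omega>"
    unfolding S_def by (subst measure_lebesgue_affine) simp
  have far: "\<bar>e \<bullet> y - t\<bar> \<ge> d / 8" if "y \<in> S" for y
  proof -
    obtain x where x: "x \<in> \<Omega>" "y = (1 / 8) *\<^sub>R x + (7 / 8) *\<^sub>R z"
      using \<open>y \<in> S\<close> unfolding S_def by blast
    have "\<bar>e \<bullet> (x - z)\<bar> \<le> norm e * norm (x - z)" by (rule Cauchy_Schwarz_ineq2)
    also have "\<dots> \<le> d"
      using diameter_bounded_bound[OF \<Omega>(2) x(1) z(1)] e \<Omega>(4) by (simp add: dist_norm)
    finally have "\<bar>e \<bullet> x - e \<bullet> z\<bar> \<le> d" by (simp add: inner_diff_right)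
    moreover have "e \<bullet> y - t = (e \<bullet> z - t) + (e \<bullet> x - e \<bullet> z) / 8"
      by (simp add: x(2) inner_add_right field_simps)
    ultimately have "e \<bullet> y - t = (e \<bullet> z - t) + (e \<bullet> x - e \<bullet> z) / 8" "\<bar>(e \<bullet> x - e \<bullet> z) / 8\<bar> \<le> d / 8"
      by auto
    then show ?thesis using z(2) abs_triangle_ineq2[of "e \<bullet> z - t" "- ((e \<bullet> x - e \<bullet> z) / 8)"]
      unfolding abs_minus_cancel diff_minus_eq_add by linarith
  qed
  obtain R where R: "\<Omega> \<subseteq> cball 0 R"
    by (meson \<Omega>(2) bounded_pos subsetI mem_cball_0)
  \<comment> \<open>Chebyshev-type estimate: only the contribution of \<open>S\<close> is kept,
    where the integrand is at least \<open>(d / 8) powr q\<close>.\<close>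
  have "(d / 8) powr q * measure lebesgue S = (\<integral>x. (d / 8) powr q * indicator S x \<partial>lebesgue_on \<Omega>)"
    using SL S\<Omega> \<Omega>L
    by (simp add: measure_restrict_space fmeasurableD Int_absorb1 Int_absorb2)
  also have "\<dots> \<le> (\<integral>x. \<bar>e \<bullet> x - t\<bar> powr q \<partial>lebesgue_on \<Omega>)"
  proof (rule integral_mono)
    show "integrable (lebesgue_on \<Omega>) (\<lambda>x. (d / 8) powr q * indicator S x)"
    proof (intro integrable_mult_right integrable_real_indicator)
      show "S \<in> sets (lebesgue_on \<Omega>)"
        using SL S\<Omega> \<Omega>L by (simp add: sets_restrict_space_iff fmeasurableD)
      have "emeasure (lebesgue_on \<Omega>) S = emeasure lebesgue S"
        using S\<Omega> \<Omega>L by (intro emeasure_restrict_space) (auto simp: fmeasurableD)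
      also have "\<dots> < \<infinity>" using SL by (simp only: fmeasurable_def mem_Collect_eq)
      finally show "emeasure (lebesgue_on \<Omega>) S < \<infinity>" .
    qed
    show "integrable (lebesgue_on \<Omega>) (\<lambda>x. \<bar>e \<bullet> x - t\<bar> powr q)"
      using R \<Omega>L q
      by (intro integrable_on_lebesgue_continuous[of "cball 0 R"])
        (auto intro!: continuous_intros continuous_on_powr' simp: fmeasurableD)
    show "(d / 8) powr q * indicator S x \<le> \<bar>e \<bullet> x - t\<bar> powr q" for x
      using far[of x] d q by (cases "x \<in> S") (auto intro: powr_mono2)
  qed
  finally show ?thesis by (simp add: mS mult.assoc)
qed

section \<open>Bounds for \<open>mu\<close> and its limit\<close>

lemma mu_nonneg: "0 \<le> mu p q \<Omega>"
  unfolding mu_def by (intro Inf_greatest) (auto intro!: divide_nonneg_nonneg)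

text \<open>The infimum is tested with \<open>v\<close>, the affine function of slope
  \<open>e\<close>. As its gradient has norm \<open>1\<close>, the numerator is exactly the measure
  \<open>m\<close>, while the denominator is at least \<open>(C * m) powr (p / q)\<close>.\<close>

lemma mu_le_measure_powr:
  fixes \<Omega> :: "'a::euclidean_space set"
  assumes \<Omega>: "open \<Omega>" "bounded \<Omega>" "convex \<Omega>" "diameter \<Omega> = d"
    and d: "0 < d" and p: "0 < p" and q: "1 < q"
  shows "mu p q \<Omega> \<le> ereal (((d / 8) powr q * (1 / 8) ^ DIM('a)) powr - (p / q) *
    measure lebesgue \<Omega> powr (1 - p / q))"
proof -
  define C where "C = (d / 8) powr q * (1 / 8) ^ DIM('a)"
  have C: "0 < C" using d by (simp add: C_def)
  define m where "m = measure lebesgue \<Omega>"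
  \<comment> \<open>The diameter of an open set need not be attained, so a pair at distance more
    than \<open>d / 2\<close> is chosen instead.\<close>
  have "\<exists>a\<in>\<Omega>. \<exists>b\<in>\<Omega>. d / 2 < dist a b"
    using \<Omega> d by (intro diameter_lower_bounded) auto
  then obtain a b where ab: "a \<in> \<Omega>" "b \<in> \<Omega>" "d / 2 < dist a b" by blast
  define e where "e = sgn (b - a)"
  have "a \<noteq> b" using ab d by auto
  then have e: "norm e = 1" by (simp add: e_def norm_sgn)
  have "e \<bullet> (b - a) = norm (b - a)"
    using \<open>a \<noteq> b\<close> by (simp add: e_def sgn_div_norm dot_square_norm power2_eq_square)
  then have eab: "e \<bullet> b - e \<bullet> a > d / 2"
    using ab by (simp add: inner_diff_right dist_norm norm_minus_commute)
  have \<Omega>L: "\<Omega> \<in> lmeasurable"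
    using \<Omega> by (simp add: lmeasurable_open)
  then have \<Omega>S: "\<Omega> \<in> sets lebesgue" by (simp add: fmeasurableD)
  obtain R where R: "\<Omega> \<subseteq> cball 0 R"
    by (meson \<Omega>(2) bounded_pos subsetI mem_cball_0)
  have "\<not> negligible \<Omega>"
    using \<Omega>(1) ab(1) open_not_negligible by blast
  then have m: "0 < m"
    using \<Omega>L unfolding m_def by (simp add: negligible_iff_measure zero_less_measure_iff)
  obtain t where t: "(\<integral>x. \<bar>e \<bullet> x - t\<bar> powr (q - 2) * (e \<bullet> x - t) \<partial>lebesgue_on \<Omega>) = 0"
    using exists_signed_powr_centre[OF q \<Omega>(2) \<Omega>S] by blast
  define v where "v = (\<lambda>x. e \<bullet> x - t)"
  define J where "J = (\<integral>x. \<bar>v x\<bar> powr q \<partial>lebesgue_on \<Omega>)"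
  \<comment> \<open>The centre \<open>t\<close> comes from an intermediate value argument and is not
    explicit; the bound applies because it is uniform in \<open>t\<close>.\<close>
  have J: "C * m \<le> J"
    unfolding C_def m_def J_def v_def
    using affine_powr_integral_lower_bound[OF \<Omega> ab(1,2) eab e d] q by simp
  have "0 < C * m" using C m by simp
  have int: "integrable (lebesgue_on \<Omega>) f" if "continuous_on UNIV f" for f :: "'a \<Rightarrow> 'b::euclidean_space"
    using R \<Omega>S by (intro integrable_on_lebesgue_continuous[of "cball 0 R"])
      (auto intro: continuous_on_subset[OF that])
  have L: "f \<in> L_space r \<Omega>" if "continuous_on UNIV f" "0 < r" for f :: "'a \<Rightarrow> 'b::euclidean_space" and r
    unfolding L_space_def
    using that by (auto intro!: int borel_measurable_integrable[OF int] continuous_intros continuous_on_powr')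
  have contv: "continuous_on UNIV v"
    unfolding v_def by (intro continuous_intros)
  have wg: "has_weak_gradient \<Omega> v (\<lambda>_. e)"
    unfolding v_def by (rule has_weak_gradient_affine) fact
  have eL: "(\<lambda>_. e) \<in> L_space p \<Omega>"
    by (rule L) (use p in auto)
  have "v \<in> sobolev_W1 p \<Omega>"
    unfolding sobolev_W1_def using wg eL L[OF contv p] by blast
  moreover have "v \<in> L_space q \<Omega>"
    using L[OF contv] q by simp
  moreover have "\<not> (AE x in lebesgue_on \<Omega>. v x = 0)"
  \<comment> \<open>If \<open>v\<close> vanished almost everywhere, then \<open>J\<close> would be
    \<open>0\<close>, against \<open>0 < C * m \<le> J\<close>.\<close>
  proof
    assume "AE x in lebesgue_on \<Omega>. v x = 0"
    then have "J = (\<integral>x. 0 \<partial>lebesgue_on \<Omega>)"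
      unfolding J_def
      by (intro integral_cong_AE borel_measurable_integrable int)
        (use q contv in \<open>auto intro!: continuous_intros continuous_on_powr'\<close>)
    then show False using J \<open>0 < C * m\<close> by simp
  qed
  moreover have "(\<integral>x. norm e powr p \<partial>lebesgue_on \<Omega>) = m"
    using \<Omega>S by (simp add: e m_def measure_restrict_space)
  ultimately have "mu p q \<Omega> \<le> ereal (m / J powr (p / q))"
    unfolding mu_def using wg eL t
    by (intro Inf_lower) (force simp: J_def v_def)
  also have "m / J powr (p / q) \<le> m / (C * m) powr (p / q)"
    using J \<open>0 < C * m\<close> m p q by (intro divide_left_mono powr_mono2 mult_pos_pos) auto
  also have "\<dots> = C powr - (p / q) * (m / m powr (p / q))"
    using C m by (simp add: powr_mult powr_minus divide_inverse)
  also have "m / m powr (p / q) = m powr (1 - p / q)"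
    using m by (simp add: powr_diff)
  finally show ?thesis by (simp add: C_def m_def)
qed

lemma mu_tendsto_0:
  fixes \<Omega> :: "nat \<Rightarrow> 'a::euclidean_space set"
  assumes "1 < p" "p < q" "0 < d"
    and \<Omega>: "\<And>k. open (\<Omega> k) \<and> bounded (\<Omega> k) \<and> convex (\<Omega> k) \<and> diameter (\<Omega> k) = d"
    and lim: "(\<lambda>k. measure lebesgue (\<Omega> k)) \<longlonglongrightarrow> 0"
  shows "(\<lambda>k. mu p q (\<Omega> k)) \<longlonglongrightarrow> 0"
proof (rule tendsto_sandwich[OF _ _ tendsto_const])
  define C where "C = ((d / 8) powr q * (1 / 8) ^ DIM('a)) powr - (p / q)"
  \<comment> \<open>From \<open>p < q\<close> the exponent \<open>1 - p / q\<close> is positive, so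
    \<open>powr\<close> with this exponent tends to \<open>0\<close> as its nonnegative base
    does.\<close>
  have "(\<lambda>k. C * measure lebesgue (\<Omega> k) powr (1 - p / q)) \<longlonglongrightarrow> C * 0 powr (1 - p / q)"
    using assms(1,2) by (intro tendsto_intros lim tendsto_powr') (auto simp: divide_simps)
  then show "(\<lambda>k. ereal (C * measure lebesgue (\<Omega> k) powr (1 - p / q))) \<longlonglongrightarrow> 0"
    by (simp add: zero_ereal_def)
  show "\<forall>\<^sub>F k in sequentially. mu p q (\<Omega> k) \<le> ereal (C * measure lebesgue (\<Omega> k) powr (1 - p / q))"
    unfolding C_def using \<Omega> assms(1-3) by (intro always_eventually allI mu_le_measure_powr) auto
qed (auto simp: mu_nonneg)

section \<open>Thin convex sets of prescribed diameter\<close>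

text \<open>A ball of diameter \<open>c\<close> is cut by ever thinner slabs orthogonal to
  \<open>b\<close>. Dimension at least two provides a second basis vector \<open>b'\<close>,
  parallel to the slabs, along which the full diameter survives.\<close>

lemma exists_thin_convex_sets:
  fixes c :: real
  assumes "2 \<le> DIM('a::euclidean_space)" "0 < c"
  obtains \<Omega> :: "nat \<Rightarrow> 'a::euclidean_space set"
  where "\<And>k. open (\<Omega> k) \<and> bounded (\<Omega> k) \<and> convex (\<Omega> k) \<and> diameter (\<Omega> k) = c"
    and "(\<lambda>k. measure lebesgue (\<Omega> k)) \<longlonglongrightarrow> 0"
proof -
  obtain b b' :: 'a where b: "b \<in> Basis" "b' \<in> Basis" "b \<noteq> b'"
    using assms(1) by (metis One_nat_def Suc_1 card_le_Suc0_iff_eq finite_Basis not_less_eq_eq)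
  define \<Omega> :: "nat \<Rightarrow> 'a set"
    where "\<Omega> = (\<lambda>k. ball 0 (c / 2) \<inter> {x. b \<bullet> x < inverse (real (Suc k))} \<inter> {x. b \<bullet> x > - inverse (real (Suc k))})"
  have op: "open (\<Omega> k)" for k
    unfolding \<Omega>_def by (intro open_Int open_ball open_halfspace_lt open_halfspace_gt)
  have bd: "bounded (\<Omega> k)" for k
    unfolding \<Omega>_def by (meson Int_lower1 bounded_ball bounded_subset)
  have co: "convex (\<Omega> k)" for k
    unfolding \<Omega>_def by (intro convex_Int convex_ball convex_halfspace_lt convex_halfspace_gt)
  have "diameter (\<Omega> k) = c" for k
  proof (rule antisym)
    have "diameter (\<Omega> k) \<le> diameter (ball (0::'a) (c / 2))"
      unfolding \<Omega>_def by (intro diameter_subset) auto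
    then show "diameter (\<Omega> k) \<le> c" using assms(2) by simp
    show "c \<le> diameter (\<Omega> k)"
    \<comment> \<open>The endpoints of the diameter along \<open>b'\<close> lie on the excluded
      sphere, so it is approached by symmetric pairs at distance \<open>s < c\<close>. These have
      zero component along \<open>b\<close> and stay in every slab.\<close>
    proof (rule dense_le_bounded[OF assms(2)])
      fix s assume s: "0 < s" "s < c"
      have "(s / 2) *\<^sub>R b' \<in> \<Omega> k" "- (s / 2) *\<^sub>R b' \<in> \<Omega> k"
        using s b by (auto simp: \<Omega>_def inner_Basis)
      from diameter_bounded_bound[OF bd this]
      show "s \<le> diameter (\<Omega> k)"
        using s b by (simp add: dist_norm flip: scaleR_add_left)
    qed
  qed
  then have \<Omega>: "open (\<Omega> k) \<and> bounded (\<Omega> k) \<and> convex (\<Omega> k) \<and> diameter (\<Omega> k) = c" for k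
    using op bd co by blast
  have L: "\<Omega> k \<in> lmeasurable" for k
    using op bd by (simp add: lmeasurable_open)
  \<comment> \<open>Continuity of the measure from above, valid since all the sets have finite
    measure, reduces the limit to the intersection, which lies in the null hyperplane orthogonal to
    \<open>b\<close>.\<close>
  have lim: "(\<lambda>k. measure lebesgue (\<Omega> k)) \<longlonglongrightarrow> measure lebesgue (\<Inter>k. \<Omega> k)"
  proof (rule Lim_measure_decseq)
    show "range \<Omega> \<subseteq> sets lebesgue" using L by (auto simp: fmeasurableD)
    show "decseq \<Omega>"
    proof (rule decseq_SucI)
      fix n
      have le: "inverse (real (Suc (Suc n))) \<le> inverse (real (Suc n))"
        by (rule le_imp_inverse_le) auto
      show "\<Omega> (Suc n) \<subseteq> \<Omega> n"
      proof
        fix x assume "x \<in> \<Omega> (Suc n)"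
        then show "x \<in> \<Omega> n"
          unfolding \<Omega>_def Int_iff mem_Collect_eq using le by linarith
      qed
    qed
    show "emeasure lebesgue (\<Omega> k) \<noteq> \<infinity>" for k
      using L[of k] unfolding fmeasurable_def by auto
  qed
  have "(\<Inter>k. \<Omega> k) \<subseteq> {x. b \<bullet> x = 0}"
  proof
    fix x assume "x \<in> (\<Inter>k. \<Omega> k)"
    then have "x \<in> \<Omega> k" for k by blast
    then have "\<bar>b \<bullet> x\<bar> \<le> inverse (real (Suc k))" for k
      unfolding \<Omega>_def Int_iff mem_Collect_eq abs_le_iff by (meson less_imp_le minus_less_iff)
    then have "\<bar>b \<bullet> x\<bar> \<le> 0"
      by (intro LIMSEQ_le_const[OF LIMSEQ_inverse_real_of_nat]) blast
    then show "x \<in> {x. b \<bullet> x = 0}" by simp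
  qed
  then have "negligible (\<Inter>k. \<Omega> k)"
    using negligible_hyperplane[of b 0] b(1) nonzero_Basis negligible_subset by blast
  then have "(\<lambda>k. measure lebesgue (\<Omega> k)) \<longlonglongrightarrow> 0"
    using lim by (simp add: negligible_imp_measure0)
  with \<Omega> show thesis by (rule that)
qed

section \<open>The infimum and its minimizing sequences\<close>

theorem mainTheorem6:
  fixes p q c :: real
  assumes "2 \<le> DIM('a::euclidean_space)"
    and "1 < p" and "p < q" and "ereal q < sobolev_exponent DIM('a) p"
    and "0 < c"
  shows "(INF \<Omega> \<in> {\<Omega> :: 'a set. open \<Omega> \<and> bounded \<Omega> \<and> convex \<Omega> \<and> diameter \<Omega> \<le> c}. mu p q \<Omega>) = 0
    \<and> (\<forall>\<Omega> :: nat \<Rightarrow> 'a set.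
          (\<forall>k. open (\<Omega> k) \<and> bounded (\<Omega> k) \<and> convex (\<Omega> k) \<and> diameter (\<Omega> k) = c) \<and>
          (\<lambda>k. measure lebesgue (\<Omega> k)) \<longlonglongrightarrow> 0
          \<longrightarrow> (\<lambda>k. mu p q (\<Omega> k)) \<longlonglongrightarrow> 0)"
proof (intro conjI allI impI)
  show "(\<lambda>k. mu p q (\<Omega> k)) \<longlonglongrightarrow> 0"
    if "(\<forall>k. open (\<Omega> k) \<and> bounded (\<Omega> k) \<and> convex (\<Omega> k) \<and> diameter (\<Omega> k) = c) \<and>
      (\<lambda>k. measure lebesgue (\<Omega> k)) \<longlonglongrightarrow> 0" for \<Omega> :: "nat \<Rightarrow> 'a set"
    using that assms by (intro mu_tendsto_0[where d = c]) auto
  obtain \<Omega> :: "nat \<Rightarrow> 'a set"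
    where \<Omega>: "\<And>k. open (\<Omega> k) \<and> bounded (\<Omega> k) \<and> convex (\<Omega> k) \<and> diameter (\<Omega> k) = c"
      and lim: "(\<lambda>k. measure lebesgue (\<Omega> k)) \<longlonglongrightarrow> 0"
    using exists_thin_convex_sets[OF assms(1,5)] by blast
  show "(INF \<Omega> \<in> {\<Omega> :: 'a set. open \<Omega> \<and> bounded \<Omega> \<and> convex \<Omega> \<and> diameter \<Omega> \<le> c}. mu p q \<Omega>) = 0"
  proof (rule antisym)
    \<comment> \<open>The infimum lies below each \<open>mu p q (\<Omega> k)\<close> of the thin
      family, hence below their limit \<open>0\<close>.\<close>
    show "(INF \<Omega> \<in> {\<Omega> :: 'a set. open \<Omega> \<and> bounded \<Omega> \<and> convex \<Omega> \<and> diameter \<Omega> \<le> c}. mu p q \<Omega>) \<le> 0"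
      using \<Omega> by (intro LIMSEQ_le_const[OF mu_tendsto_0[OF assms(2,3,5) \<Omega> lim]] exI[of _ 0] allI impI INF_lower)
        (simp add: order.eq_iff)
  qed (auto intro: INF_greatest mu_nonneg)
qed

end
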